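(* Let $P=\{p_k;k\ge 1\}$ be a probability distribution on a countable alphabet, and let $t_n=\sum_{k\ge 1}np_k(1-p_k)^n$ for $n\ge 1$. If there exist constants $a>1$, $c>0$ and an integer $k_0\ge 1$ such that $p_k=ca^{-k}$ for all $k\ge k_0$, then (1) there is an upper bound $u_a>0$, which may depend on $a$, such that $t_n\le u_a$ for all $n\geq 1$; and (2) $\lim_{n\to\infty}t_n$ does not exist.
   Context: A probability distribution on the countable alphabet $\mathscr{X}=\{\ell_k;k\ge 1\}$ is a sequence $P=\{p_k;k\ge 1\}$ with $p_k\ge 0$ and $\sum_{k\ge1}p_k=1$. The quantity $t_n$ is called the tail index of $P$. *)

theory Defs
  imports "HOL-Analysis.Infinite_Sum"
begin

(* Sequences are indexed by k \<ge> 1; the value at 0 is irrelevant. *)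
definition prob_distribution :: "(nat \<Rightarrow> real) \<Rightarrow> bool" where
  "prob_distribution p \<longleftrightarrow> (\<forall>k\<ge>1. 0 \<le> p k) \<and> (p has_sum 1) {1..}"

(* For a probability distribution the terms are nonnegative and dominated by n * p k,
   so the unordered sum always converges and equals the series taken in order. *)
definition tail_index :: "(nat \<Rightarrow> real) \<Rightarrow> nat \<Rightarrow> real" where
  "tail_index p n = (\<Sum>\<^sub>\<infinity>k\<in>{1..}. real n * p k * (1 - p k) ^ n)"

end

theory Submission
  imports Defs "HOL-Real_Asymp.Real_Asymp"
begin

text \<open>
  Boundedness: if \<open>p\<close> is geometric with ratio \<open>1/a\<close>, then \<open>p k\<close> is proportional to
  \<open>p k - p (Suc k)\<close>, so \<open>\<Sum>k. n * p k * (1 - p k) ^ n\<close> is at most \<open>a / (a - 1)\<close> times a lower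
  Riemann sum of \<open>\<integral>\<^sub>0\<^sup>1 n * (1 - x) ^ n dx < 1\<close>.

  Divergence: expanding
  \<open>(1 - q) ^ m\<close> binomially, with \<open>q = (1 - p k) ^ n\<close>, gives
  \<open>\<Sum>k. n * p k * q * (1 - q) ^ m = \<Sum>i\<le>m. (-1) ^ i * (m choose i) / (i + 1) * tail_index p (n * (i + 1))\<close>.
  If the tail index converged to \<open>L\<close>, the right-hand side would tend to \<open>L / (m + 1)\<close> as
  \<open>n \<rightarrow> \<infinity>\<close>. Choosing \<open>n\<close> close to \<open>ln (m + 1) / p k\<close> makes the single \<open>k\<close>-th summand on
  the left at least about \<open>ln (m + 1) / (e * (m + 1))\<close>. Hence \<open>ln (m + 1) \<le> e * L\<close> for all \<open>m\<close>,
  which is absurd.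
\<close>

section \<open>Elementary facts about distributions and the tail index\<close>

lemma prob_distribution_nonneg: "prob_distribution p \<Longrightarrow> 1 \<le> k \<Longrightarrow> 0 \<le> p k"
  by (simp add: prob_distribution_def)

lemma prob_distribution_le_1:
  assumes "prob_distribution p" "1 \<le> k"
  shows "p k \<le> 1"
  using finite_sum_le_has_sum[of p "{1..}" 1 "{k}"] assms
  by (auto simp: prob_distribution_def)

lemma prob_distribution_tendsto_0:
  assumes "prob_distribution p"
  shows "p \<longlonglongrightarrow> 0"
proof -
  have "(p has_sum 1) {1..}" using assms by (simp add: prob_distribution_def)
  \<comment> \<open>\<open>p 0\<close> is unconstrained, so it is replaced by 0 to pass from a sum
    over \<open>{1..}\<close> to an ordinary series.\<close>
  then have "((\<lambda>k. if k = 0 then 0 else p k) has_sum 1) UNIV"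
    by (subst has_sum_cong_neutral[where T = "{1..}" and g = p]) auto
  then have "summable (\<lambda>k. if k = 0 then 0 else p k)"
    using has_sum_imp_sums sums_summable by blast
  then have "(\<lambda>k. if k = 0 then 0 else p k) \<longlonglongrightarrow> 0"
    by (rule summable_LIMSEQ_zero)
  then show ?thesis
    by (rule Lim_transform_eventually) (rule eventually_mono[OF eventually_gt_at_top[of 0]], simp)
qed

lemma tail_index_summable:
  assumes "prob_distribution p"
  shows "(\<lambda>k. real n * p k * (1 - p k) ^ n) summable_on {1..}"
proof (rule summable_on_comparison_test)
  show "(\<lambda>k. real n * p k) summable_on {1..}"
    using assms by (intro summable_on_cmult_right) (auto simp: prob_distribution_def summable_on_def)
next
  fix k :: nat assume "k \<in> {1..}"
  then have "0 \<le> p k" "p k \<le> 1"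
    using assms prob_distribution_nonneg prob_distribution_le_1 by auto
  then show "real n * p k * (1 - p k) ^ n \<le> real n * p k" "0 \<le> real n * p k * (1 - p k) ^ n"
    by (auto intro!: mult_left_le power_le_one)
qed

section \<open>Uniform upper bound\<close>

text \<open>Bernoulli bounds \<open>n * x\<close> by \<open>(1 + x) ^ n\<close>, and
  \<open>(1 + x) * (1 - x)\<close> is at most 1. This controls the finitely many terms before
  \<open>k0\<close>.\<close>

lemma mult_one_minus_power_le_1:
  fixes x :: real
  assumes "0 \<le> x" "x \<le> 1"
  shows "real n * x * (1 - x) ^ n \<le> 1"
proof -
  have "real n * x * (1 - x) ^ n \<le> (1 + x) ^ n * (1 - x) ^ n"
    using Bernoulli_inequality[of x n] assms by (intro mult_right_mono) auto
  also have "\<dots> = (1 - x * x) ^ n"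
    by (simp add: power_mult_distrib[symmetric] algebra_simps)
  also have "\<dots> \<le> 1"
    using assms by (intro power_le_one) (auto simp: mult_le_one)
  finally show ?thesis .
qed

text \<open>The right side is the integral of \<open>Suc n * x ^ n\<close> from \<open>d\<close> to
  \<open>b\<close>, and the integrand is smallest at \<open>d\<close>. Induction replaces the
  integration.\<close>

lemma power_Suc_diff_ge:
  fixes b d :: real
  assumes "0 \<le> d" "d \<le> b"
  shows "real (Suc n) * d ^ n * (b - d) \<le> b ^ Suc n - d ^ Suc n"
proof (induction n)
  case (Suc n)
  have "real (Suc n) * d ^ n * (b - d) * d \<le> real (Suc n) * d ^ n * (b - d) * b"
    using assms by (intro mult_left_mono) auto
  also have "\<dots> \<le> (b ^ Suc n - d ^ Suc n) * b"
    using Suc assms by (intro mult_right_mono) auto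
  finally show ?case by (simp add: algebra_simps)
qed simp

text \<open>The recurrence makes \<open>p k\<close> equal to \<open>a / (a - 1)\<close> times the
  gap \<open>p k - p (Suc k)\<close>. By \<open>power_Suc_diff_ge\<close> the terms are then
  dominated by differences that telescope, so the bound is free of both \<open>n\<close> and
  \<open>N\<close>.\<close>

lemma geometric_sum_le:
  fixes p :: "nat \<Rightarrow> real"
  assumes "a > 1" and p: "\<And>k. k \<ge> k0 \<Longrightarrow> 0 \<le> p k \<and> p k \<le> 1 \<and> p k = a * p (Suc k)"
  shows "(\<Sum>k = k0..<N. real n * p k * (1 - p k) ^ n) \<le> a / (a - 1)"
proof (cases "k0 \<le> N")
  case True
  have "(\<Sum>k = k0..<N. real n * p k * (1 - p k) ^ n)
      \<le> (\<Sum>k = k0..<N. a / (a - 1) * ((1 - p (Suc k)) ^ Suc n - (1 - p k) ^ Suc n))"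
  proof (rule sum_mono)
    fix k assume "k \<in> {k0..<N}"
    then have k: "0 \<le> p k" "p k \<le> 1" "p k = a * p (Suc k)" "0 \<le> p (Suc k)"
      using p[of k] p[of "Suc k"] by auto
    then have "1 * p (Suc k) \<le> a * p (Suc k)"
      using \<open>a > 1\<close> by (intro mult_right_mono) auto
    then have le: "p (Suc k) \<le> p k" using k by simp
    \<comment> \<open>Enlarging \<open>n\<close> to \<open>Suc n\<close> produces the exact
      derivative factor of \<open>x ^ Suc n\<close>.\<close>
    have "real n * p k * (1 - p k) ^ n \<le> real (Suc n) * p k * (1 - p k) ^ n"
      using k by (intro mult_right_mono) auto
    also have "\<dots> = real (Suc n) * (a / (a - 1) * (p k - p (Suc k))) * (1 - p k) ^ n"
    proof -
      have "p k * (a - 1) = a * (p k - p (Suc k))"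
        using k(3) by (simp add: algebra_simps)
      then show ?thesis using \<open>a > 1\<close> by (simp add: eq_divide_eq)
    qed
    also have "\<dots> = a / (a - 1) * (real (Suc n) * (1 - p k) ^ n * ((1 - p (Suc k)) - (1 - p k)))"
      by (simp only: mult_ac diff_diff_eq2 add_diff_cancel_left' diff_add_cancel) simp
    also have "\<dots> \<le> a / (a - 1) * ((1 - p (Suc k)) ^ Suc n - (1 - p k) ^ Suc n)"
      using power_Suc_diff_ge[of "1 - p k" "1 - p (Suc k)" n] k le \<open>a > 1\<close>
      by (intro mult_left_mono) auto
    finally show "real n * p k * (1 - p k) ^ n
      \<le> a / (a - 1) * ((1 - p (Suc k)) ^ Suc n - (1 - p k) ^ Suc n)" .
  qed
  also have "\<dots> = a / (a - 1) * ((1 - p N) ^ Suc n - (1 - p k0) ^ Suc n)"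
    unfolding sum_distrib_left[symmetric]
    by (subst sum_Suc_diff'[OF True]) simp
  also have "\<dots> \<le> a / (a - 1) * 1"
  proof (rule mult_left_mono)
    have "(1 - p N) ^ Suc n \<le> 1" "0 \<le> (1 - p k0) ^ Suc n"
      using p[of N] p[of k0] True by (auto intro!: power_le_one zero_le_power simp del: power_Suc)
    then show "(1 - p N) ^ Suc n - (1 - p k0) ^ Suc n \<le> 1" by linarith
  qed (use \<open>a > 1\<close> in auto)
  finally show ?thesis by simp
qed (use \<open>a > 1\<close> in auto)

text \<open>Each term before \<open>k0\<close> is at most 1, which accounts for
  \<open>real k0\<close>; the geometric tail accounts for the rest.\<close>

lemma tail_index_le:
  assumes "prob_distribution p" "a > 1" "k0 \<ge> 1"
    and "\<And>k. k \<ge> k0 \<Longrightarrow> p k = a * p (Suc k)"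
  shows "tail_index p n \<le> real k0 + a / (a - 1)"
  unfolding tail_index_def
proof (rule infsum_le_finite_sums)
  note bounds = prob_distribution_nonneg[OF assms(1)] prob_distribution_le_1[OF assms(1)]
  let ?f = "\<lambda>k. real n * p k * (1 - p k) ^ n"
  show "?f summable_on {1..}" using assms(1) by (rule tail_index_summable)
  fix F :: "nat set" assume F: "finite F" "F \<subseteq> {1..}"
  then obtain N where N: "F \<subseteq> {..<N}" using finite_nat_iff_bounded by blast
  have "sum ?f F \<le> sum ?f ({1..<k0} \<union> {k0..<N})"
    using F N bounds \<open>k0 \<ge> 1\<close> by (intro sum_mono2) auto
  also have "\<dots> = sum ?f {1..<k0} + sum ?f {k0..<N}"
    by (rule sum.union_disjoint) auto
  also have "sum ?f {1..<k0} \<le> (\<Sum>k\<in>{1..<k0}. 1)"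
    using bounds by (intro sum_mono mult_one_minus_power_le_1) auto
  also have "\<dots> \<le> real k0" by simp
  also have "sum ?f {k0..<N} \<le> a / (a - 1)"
  proof (rule geometric_sum_le[OF \<open>a > 1\<close>])
    fix k assume "k0 \<le> k"
    then show "0 \<le> p k \<and> p k \<le> 1 \<and> p k = a * p (Suc k)"
      using bounds[of k] \<open>k0 \<ge> 1\<close> assms(4)[of k] by linarith
  qed
  finally show "sum ?f F \<le> real k0 + a / (a - 1)" by simp
qed

section \<open>Alternating binomial combinations of tail indices\<close>

text \<open>Absorption moves the coefficients to row \<open>Suc m\<close>, whose alternating sum
  vanishes. The result is the total weight that a common limit of the tail indices receives.\<close>

lemma sum_alternating_choose_div:
  "(\<Sum>i\<le>m. (-1) ^ i * real (m choose i) / real (Suc i)) = 1 / real (Suc m)"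
proof -
  have "(\<Sum>i\<le>m. (-1) ^ i * real (m choose i) / real (Suc i))
      = (\<Sum>i\<le>m. - ((-1) ^ Suc i * real (Suc m choose Suc i)) / real (Suc m))"
  proof (rule sum.cong)
    fix i
    have "real (Suc i) * real (Suc m choose Suc i) = real (Suc m) * real (m choose i)"
      using Suc_times_binomial[of i m] by (metis of_nat_mult)
    then show "(-1) ^ i * real (m choose i) / real (Suc i)
        = - ((-1) ^ Suc i * real (Suc m choose Suc i)) / real (Suc m)"
      by (simp add: divide_simps del: of_nat_Suc binomial_Suc_Suc) (simp add: mult.commute)
  qed simp
  also have "\<dots> = - (\<Sum>i\<le>m. (-1) ^ Suc i * real (Suc m choose Suc i)) / real (Suc m)"
    by (simp only: sum_divide_distrib[symmetric] sum_negf)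
  \<comment> \<open>The full row sums to 0, and the missing leading entry is 1.\<close>
  also have "(\<Sum>i\<le>m. (-1) ^ Suc i * real (Suc m choose Suc i)) = -1"
    using choose_alternating_sum[of "Suc m", where ?'a = real]
    unfolding sum.atMost_Suc_shift by simp
  finally show ?thesis by simp
qed

lemma has_sum_sum:
  fixes f :: "'i \<Rightarrow> 'a \<Rightarrow> 'b::topological_comm_monoid_add"
  assumes "\<And>i. i \<in> I \<Longrightarrow> (f i has_sum s i) A"
  shows "((\<lambda>x. \<Sum>i\<in>I. f i x) has_sum (\<Sum>i\<in>I. s i)) A"
  using assms by (induction I rule: infinite_finite_induct) (auto intro: has_sum_add)

text \<open>The index \<open>n * Suc i\<close> contributes a factor \<open>Suc i\<close>, cancelled
  by the denominator, and the power \<open>q ^ Suc i\<close> with \<open>q = (1 - p k) ^ n\<close>;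
  what remains is the expansion of \<open>(1 - q) ^ m\<close>.\<close>

lemma has_sum_tail_index_combination:
  assumes "prob_distribution p"
  shows "((\<lambda>k. real n * p k * (1 - p k) ^ n * (1 - (1 - p k) ^ n) ^ m) has_sum
    (\<Sum>i\<le>m. (-1) ^ i * real (m choose i) / real (Suc i) * tail_index p (n * Suc i))) {1..}"
proof -
  have "((\<lambda>k. \<Sum>i\<le>m. (-1) ^ i * real (m choose i) / real (Suc i) *
      (real (n * Suc i) * p k * (1 - p k) ^ (n * Suc i))) has_sum
    (\<Sum>i\<le>m. (-1) ^ i * real (m choose i) / real (Suc i) * tail_index p (n * Suc i))) {1..}"
    unfolding tail_index_def
    by (intro has_sum_sum has_sum_cmult_right has_sum_infsum tail_index_summable assms)
  moreover have "(\<Sum>i\<le>m. (-1) ^ i * real (m choose i) / real (Suc i) *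
      (real (n * Suc i) * x * (1 - x) ^ (n * Suc i)))
    = real n * x * (1 - x) ^ n * (1 - (1 - x) ^ n) ^ m" for x
  proof -
    let ?q = "(1 - x) ^ n"
    have "(1 - ?q) ^ m = (\<Sum>i\<le>m. real (m choose i) * (- ?q) ^ i)"
      using binomial_ring[of "- ?q" 1 m] by simp
    also have "real n * x * ?q * \<dots> = (\<Sum>i\<le>m. (-1) ^ i * real (m choose i) / real (Suc i) *
        (real (n * Suc i) * x * (1 - x) ^ (n * Suc i)))"
      unfolding sum_distrib_left
    proof (rule sum.cong)
      fix i
      have "(1 - x) ^ (n * Suc i) = ?q * ?q ^ i"
        by (simp only: power_mult power_Suc)
      moreover have "(- ?q) ^ i = (-1) ^ i * ?q ^ i" by (rule power_minus)
      ultimately show "real n * x * ?q * (real (m choose i) * (- ?q) ^ i)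
        = (-1) ^ i * real (m choose i) / real (Suc i) *
          (real (n * Suc i) * x * (1 - x) ^ (n * Suc i))"
        by (simp only: of_nat_mult) (simp add: field_simps)
    qed simp
    finally show ?thesis by simp
  qed
  ultimately show ?thesis by simp
qed

section \<open>Divergence\<close>

lemma ln_le_of_tail_index_tendsto:
  assumes P: "prob_distribution p" and pos: "\<forall>\<^sub>F k in sequentially. 0 < p k"
    and L: "tail_index p \<longlonglongrightarrow> L" and m: "m \<ge> 1"
  shows "ln (real (Suc m)) \<le> exp 1 * L"
proof -
  define y where "y = ln (real (Suc m))"
  have y: "y > 0" using m by (simp add: y_def)
  \<comment> \<open>With this choice \<open>(1 - p k) ^ N k\<close> tends to
    \<open>exp (- y) = 1 / Suc m\<close>, the maximizer of \<open>q * (1 - q) ^ m\<close> on the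
    unit interval.\<close>
  define N where "N k = nat \<lceil>y / p k\<rceil>" for k
  have p0: "p \<longlonglongrightarrow> 0" using P by (rule prob_distribution_tendsto_0)
  have p: "filterlim p (at_right 0) sequentially"
    using p0 pos by (auto simp: filterlim_at elim: eventually_mono)
  have N_ge: "y / p k \<le> real (N k)" for k
    unfolding N_def by linarith
  have N_le: "\<forall>\<^sub>F k in sequentially. real (N k) \<le> y / p k + 1"
    using pos
  proof eventually_elim
    case (elim k)
    then have "0 < y / p k" using y by simp
    then show ?case unfolding N_def by linarith
  qed
  have "filterlim (\<lambda>x. y / x) at_top (at_right 0)" using y by real_asymp
  then have "filterlim (\<lambda>k. y / p k) at_top sequentially"
    using p by (rule filterlim_compose)
  then have "filterlim (\<lambda>k. real (N k)) at_top sequentially"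
    by (rule filterlim_at_top_mono) (simp add: N_ge)
  then have N: "filterlim N sequentially sequentially"
    by (simp add: filterlim_sequentially_iff_filterlim_real)
  have Np: "(\<lambda>k. real (N k) * p k) \<longlonglongrightarrow> y"
  proof (rule tendsto_sandwich)
    show "\<forall>\<^sub>F k in sequentially. y \<le> real (N k) * p k"
      using pos
    proof eventually_elim
      case (elim k)
      then show ?case using N_ge[of k] by (simp add: pos_divide_le_eq)
    qed
    show "\<forall>\<^sub>F k in sequentially. real (N k) * p k \<le> y + p k"
      using pos N_le by eventually_elim (simp add: field_simps)
    show "(\<lambda>k. y + p k) \<longlonglongrightarrow> y" using tendsto_add[OF tendsto_const p0] by simp
  qed simp
  \<comment> \<open>The power is written as \<open>exp\<close> of a product whose factors
    \<open>N k * p k\<close> and \<open>ln (1 - p k) / p k\<close> have separate limits.\<close>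
  have "((\<lambda>x::real. ln (1 - x) / x) \<longlongrightarrow> -1) (at_right 0)" by real_asymp
  then have "(\<lambda>k. ln (1 - p k) / p k) \<longlonglongrightarrow> -1" using p by (rule filterlim_compose)
  then have "(\<lambda>k. exp (real (N k) * p k * (ln (1 - p k) / p k))) \<longlonglongrightarrow> exp (y * -1)"
    by (intro tendsto_intros Np)
  moreover have "\<forall>\<^sub>F k in sequentially. p k < 1"
    using p0 by (rule order_tendstoD) simp
  with pos have "\<forall>\<^sub>F k in sequentially.
      exp (real (N k) * p k * (ln (1 - p k) / p k)) = (1 - p k) ^ N k"
    by eventually_elim (simp add: exp_of_nat_mult)
  ultimately have "(\<lambda>k. (1 - p k) ^ N k) \<longlonglongrightarrow> exp (y * -1)"
    by (rule Lim_transform_eventually)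
  also have "exp (y * -1) = 1 / real (Suc m)"
    by (simp add: y_def exp_minus field_simps)
  finally have q: "(\<lambda>k. (1 - p k) ^ N k) \<longlonglongrightarrow> 1 / real (Suc m)" .

  have lhs: "(\<lambda>k. real (N k) * p k * (1 - p k) ^ N k * (1 - (1 - p k) ^ N k) ^ m)
      \<longlonglongrightarrow> y * (1 / real (Suc m)) * (1 - 1 / real (Suc m)) ^ m"
    by (intro tendsto_intros Np q)
  have "(\<lambda>k. tail_index p (N k * Suc i)) \<longlonglongrightarrow> L" for i
  proof -
    have "filterlim (\<lambda>k. N k * Suc i) sequentially sequentially"
      using N by (rule filterlim_at_top_mono) simp
    with L show ?thesis by (rule filterlim_compose)
  qed
  then have "(\<lambda>k. \<Sum>i\<le>m. (-1) ^ i * real (m choose i) / real (Suc i) * tail_index p (N k * Suc i))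
      \<longlonglongrightarrow> (\<Sum>i\<le>m. (-1) ^ i * real (m choose i) / real (Suc i) * L)"
    by (intro tendsto_sum tendsto_mult tendsto_const)
  then have rhs: "(\<lambda>k. \<Sum>i\<le>m. (-1) ^ i * real (m choose i) / real (Suc i) * tail_index p (N k * Suc i))
      \<longlonglongrightarrow> L / real (Suc m)"
    unfolding sum_distrib_right[symmetric] sum_alternating_choose_div by simp
  have "\<forall>\<^sub>F k in sequentially.
      real (N k) * p k * (1 - p k) ^ N k * (1 - (1 - p k) ^ N k) ^ m
      \<le> (\<Sum>i\<le>m. (-1) ^ i * real (m choose i) / real (Suc i) * tail_index p (N k * Suc i))"
    using eventually_ge_at_top[of 1]
  proof eventually_elim
    case (elim k)
    let ?f = "\<lambda>j. real (N k) * p j * (1 - p j) ^ N k * (1 - (1 - p j) ^ N k) ^ m"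
    \<comment> \<open>Here \<open>k\<close> fixes the exponent \<open>N k\<close> and also selects
      the one summand kept; the others are nonnegative.\<close>
    have "sum ?f {k} \<le>
        (\<Sum>i\<le>m. (-1) ^ i * real (m choose i) / real (Suc i) * tail_index p (N k * Suc i))"
    proof (rule finite_sum_le_has_sum[OF has_sum_tail_index_combination[OF P]])
      fix j assume "j \<in> {1..} - {k}"
      then have "0 \<le> p j" "p j \<le> 1"
        using prob_distribution_nonneg[OF P] prob_distribution_le_1[OF P] by auto
      then show "0 \<le> ?f j" by (simp add: power_le_one)
    qed (use elim in auto)
    then show ?case by simp
  qed
  \<comment> \<open>Both limits carry the factor \<open>1 / Suc m\<close>, which cancels.\<close>
  from tendsto_le[OF _ rhs lhs this]
  have "y * (1 - 1 / real (Suc m)) ^ m \<le> L"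
    by (simp add: divide_simps mult.commute del: of_nat_Suc)
  \<comment> \<open>The right side is the reciprocal of \<open>(1 + 1 / m) ^ m\<close>, which is at
    most \<open>exp 1\<close>.\<close>
  moreover have "exp (-1) \<le> (1 - 1 / real (Suc m)) ^ m"
  proof -
    have "(1 + 1 / real m) ^ m \<le> exp 1"
      using exp_ge_one_plus_x_over_n_power_n[of m 1] m by simp
    moreover have "(1 + 1 / real m) ^ m * (1 - 1 / real (Suc m)) ^ m = 1"
    proof -
      have "(1 + 1 / real m) * (1 - 1 / real (Suc m)) = 1"
        using m by (simp add: divide_simps)
      then show ?thesis by (simp add: power_mult_distrib[symmetric])
    qed
    moreover have "0 \<le> (1 - 1 / real (Suc m)) ^ m" by simp
    ultimately have "1 \<le> exp 1 * (1 - 1 / real (Suc m)) ^ m"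
      by (metis mult_right_mono)
    then show ?thesis by (simp add: exp_minus field_simps del: of_nat_Suc)
  qed
  then have "y * exp (-1) \<le> y * (1 - 1 / real (Suc m)) ^ m"
    using y by (intro mult_left_mono) auto
  ultimately have "y * exp (-1) \<le> L" by linarith
  then show ?thesis by (simp add: y_def exp_minus field_simps)
qed

text \<open>A limit \<open>L\<close> would be fixed while \<open>m\<close> is free, so the logarithm
  in \<open>ln_le_of_tail_index_tendsto\<close> outgrows \<open>exp 1 * L\<close>.\<close>

lemma not_convergent_tail_index:
  assumes "prob_distribution p" "\<forall>\<^sub>F k in sequentially. 0 < p k"
  shows "\<not> convergent (tail_index p)"
proof
  assume "convergent (tail_index p)"
  then obtain L where "tail_index p \<longlonglongrightarrow> L" by (auto simp: convergent_def)
  then have le: "ln (real (Suc m)) \<le> exp 1 * L" if "m \<ge> 1" for m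
    using ln_le_of_tail_index_tendsto assms that by blast
  have "filterlim (\<lambda>m. ln (real (Suc m))) at_top sequentially" by real_asymp
  then have "\<forall>\<^sub>F m in sequentially. exp 1 * L < ln (real (Suc m))"
    by (simp add: filterlim_at_top_dense)
  then have "\<forall>\<^sub>F m::nat in sequentially. False"
    using eventually_ge_at_top[of 1] by eventually_elim (use le in force)
  then show False by simp
qed

theorem theorem3:
  fixes p :: "nat \<Rightarrow> real" and a c :: real and k0 :: nat
  assumes "prob_distribution p"
    and "a > 1" and "c > 0" and "k0 \<ge> 1"
    and "\<And>k. k \<ge> k0 \<Longrightarrow> p k = c * a powi (- int k)"
  shows "(\<exists>u>0. \<forall>n\<ge>1. tail_index p n \<le> u) \<and> \<not> convergent (tail_index p)"
proof
  have p: "p k = c / a ^ k" if "k \<ge> k0" for k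
    using assms(5)[OF that] by (simp add: power_int_minus field_simps)
  have "tail_index p n \<le> real k0 + a / (a - 1)" for n
    using assms(1,2,4)
  proof (rule tail_index_le)
    show "p k = a * p (Suc k)" if "k \<ge> k0" for k
      using p[OF that] p[of "Suc k"] that \<open>a > 1\<close> by simp
  qed
  moreover have "real k0 + a / (a - 1) > 0"
    using assms(2,4) by (simp add: add_pos_pos)
  ultimately show "\<exists>u>0. \<forall>n\<ge>1. tail_index p n \<le> u" by blast
  have "\<forall>\<^sub>F k in sequentially. 0 < p k"
    using eventually_ge_at_top[of k0] by eventually_elim (use p assms in auto)
  with assms(1) show "\<not> convergent (tail_index p)" by (rule not_convergent_tail_index)
qed

end
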